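(* Let $A,\Pi_1,\Pi_2\subset\mathbb{R}\setminus\{0\}$ be finite sets with $|\Pi_1|,|\Pi_2|\geq|A|$. \begin{enumerate} \item[(i)] If $T\geq1$ is such that $r_{\Pi_1\Pi_2}(a)\geq T$ for all $a\in A$, then \[ |A+A|^{19}|\Pi_1|^{22}|\Pi_2|^{22}\gg |A|^{41}T^{33}(\log|A|)^{-23}\,. \] \item[(ii)] If $A$ is a convex set, then \[ |A+A|\gg |A|^{30/19}(\log|A|)^{-23/19}\,. \] \end{enumerate}
   Context: $r_{\Pi_1\Pi_2}(a)=|\{(p,q)\in\Pi_1\times\Pi_2: pq=a\}|$; $A+A=\{a+b:a,b\in A\}$. A finite set $A=\{a_1<\dots<a_n\}\subseteq\mathbb{R}$ is convex if $a_{i+1}-a_i$ is strictly increasing in $i$. $X\gg Y$ means $X\geq cY$ for an absolute constant $c>0$. $|A|$ is assumed to exceed a sufficiently large absolute constant. *)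

theory Defs
  imports Complex_Main "HOL-Library.Set_Algebras"
begin

definition mult_reps :: "real set \<Rightarrow> real set \<Rightarrow> real \<Rightarrow> nat" where
  "mult_reps P Q a = card {(p, q). p \<in> P \<and> q \<in> Q \<and> p * q = a}"

text \<open>Convexity in the additive-combinatorial sense for finite sets of reals; unrelated to
  the constant \<open>convex\<close> for subsets of a vector space.\<close>

definition convex_fin_set :: "real set \<Rightarrow> bool" where
  "convex_fin_set A \<longleftrightarrow>
     (\<exists>(n :: nat) (a :: nat \<Rightarrow> real).
        A = a ` {1..n} \<and> strict_mono_on {1..n} a \<and>
        strict_mono_on {1..<n} (\<lambda>i. a (i + 1) - a i))"

end

theory Submission
  imports Defs "HOL-Analysis.Convex" "HOL-Library.Discrete_Functions"
begin

text \<open>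
  Both parts are instances of one statement about a grid of values \<open>g p q\<close> in which every row is
  monotone in \<open>q\<close> and two rows have no common increment: \<open>g p q = p q\<close> for products, and
  \<open>g p q = a (q - p)\<close> for a convex set, where every element has \<open>T = |A|\<close> representations.
  The translates \<open>x = g p q - b\<close> are pseudolines, and since the points form a Cartesian product, the
  Szemeredi--Trotter bound for them needs no cell decomposition: cut \<open>Q\<close> and \<open>X\<close> into consecutive
  blocks; a monotone curve meets few of the resulting boxes, and two points in a box lie on at most one curve.
  This bounds the number of \<open>t\<close>-rich differences in \<open>A - B\<close> by a multiple of
  \<open>(|P| |Q| |B|)\<^sup>2 / (T t)\<^sup>3\<close>, so that \<open>\<Sum>x. r\<^bsub>A-B\<^esub>(x)\<^sup>3 \<le> M |B|\<^sup>2\<close> for every finite \<open>B\<close>,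
  with \<open>M\<close> of order \<open>(|P| |Q|)\<^sup>2 T\<^sup>-\<^sup>3 log |A|\<close>.

  Let \<open>S = A + A\<close>, let \<open>\<Pi>\<close> be the set of popular sums, and let \<open>D\<close> be the dyadic level of differences, of
  popularity \<open>\<delta>\<close>, that dominates the energy of (most of) \<open>A\<close>. Mapping the triples \<open>(a, b, c)\<close> with
  \<open>a - b \<in> D\<close> to \<open>(a + c, b + c) \<in> \<Pi>\<^sup>2\<close>, Cauchy--Schwarz and the third moment of \<open>A - A\<close> give
  many pairs in \<open>\<Pi>\<^sup>2\<close> with difference in \<open>D\<close>. Each of them yields \<open>|A|\<^sup>2 / (8 |S|)\<close> solutions of
  \<open>x + q = a + c\<close> with \<open>x \<in> D\<close>, \<open>q \<in> \<Pi>\<close>, whose number \<open>\<Sum>y. r\<^bsub>A-D\<^esub>(y) r\<^bsub>\<Pi>-A\<^esub>(y)\<close> is bounded from above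
  by Hoelder's inequality and the third moments of \<open>A - D\<close> and \<open>A - \<Pi>\<close>.
\<close>

subsection \<open>Cauchy--Schwarz inequalities\<close>

text \<open>Cauchy-Schwarz for \<open>sqrt (a i)\<close> and \<open>sqrt (b i)\<close>; the
  pointwise hypothesis keeps square roots out of the applications.\<close>

lemma sum_power2_le_mult_sum:
  fixes a b c :: "'i \<Rightarrow> real"
  assumes "\<And>i. i \<in> I \<Longrightarrow> 0 \<le> a i" "\<And>i. i \<in> I \<Longrightarrow> 0 \<le> b i"
    and "\<And>i. i \<in> I \<Longrightarrow> (c i)\<^sup>2 \<le> a i * b i"
  shows "(\<Sum>i\<in>I. c i)\<^sup>2 \<le> (\<Sum>i\<in>I. a i) * (\<Sum>i\<in>I. b i)"
proof -
  have "\<bar>c i\<bar> \<le> sqrt (a i) * sqrt (b i)" if "i \<in> I" for i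
    using real_sqrt_le_mono[OF assms(3)[OF that]] by (simp add: real_sqrt_mult)
  then have "\<bar>\<Sum>i\<in>I. c i\<bar> \<le> (\<Sum>i\<in>I. sqrt (a i) * sqrt (b i))"
    by (rule order.trans[OF sum_abs sum_mono])
  then have "(\<Sum>i\<in>I. c i)\<^sup>2 \<le> (\<Sum>i\<in>I. sqrt (a i) * sqrt (b i))\<^sup>2"
    by (rule abs_le_square_iff[THEN iffD1, OF order.trans]) simp
  also have "\<dots> \<le> (\<Sum>i\<in>I. (sqrt (a i))\<^sup>2) * (\<Sum>i\<in>I. (sqrt (b i))\<^sup>2)"
    by (rule Cauchy_Schwarz_ineq_sum)
  also have "\<dots> = (\<Sum>i\<in>I. a i) * (\<Sum>i\<in>I. b i)"
    using assms by simp
  finally show ?thesis .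
qed

text \<open>Two applications of Cauchy--Schwarz, \<open>u\<^sup>2 \<le> v G\<close> and \<open>v\<^sup>2 \<le> u F\<close>
  for \<open>u = \<Sum>f g\<^sup>2\<close> and \<open>v = \<Sum>f\<^sup>2 g\<close>, replace Hoelder's inequality.\<close>

lemma sum_mult_power2_power3_le:
  fixes f g :: "'i \<Rightarrow> real"
  assumes "\<And>i. i \<in> I \<Longrightarrow> 0 \<le> f i" "\<And>i. i \<in> I \<Longrightarrow> 0 \<le> g i"
  shows "(\<Sum>i\<in>I. f i * g i ^ 2) ^ 3 \<le> (\<Sum>i\<in>I. f i ^ 3) * (\<Sum>i\<in>I. g i ^ 3)\<^sup>2"
    (is "?u ^ 3 \<le> ?F * ?G\<^sup>2")
proof -
  define v where "v = (\<Sum>i\<in>I. f i ^ 2 * g i)"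
  have u: "?u\<^sup>2 \<le> v * ?G"
    unfolding v_def using assms
    by (intro sum_power2_le_mult_sum) (auto simp: power2_eq_square power3_eq_cube mult_ac)
  have v: "v\<^sup>2 \<le> ?F * ?u"
    unfolding v_def using assms
    by (intro sum_power2_le_mult_sum) (auto simp: power2_eq_square power3_eq_cube mult_ac)
  have pos: "0 \<le> ?u" "0 \<le> v" "0 \<le> ?F" "0 \<le> ?G"
    unfolding v_def using assms by (auto intro!: sum_nonneg mult_nonneg_nonneg)
  show ?thesis
  proof (cases "?u = 0")
    case False
    have "?u * ?u ^ 3 = (?u\<^sup>2)\<^sup>2" by (simp add: power2_eq_square power3_eq_cube)
    also have "\<dots> \<le> (v * ?G)\<^sup>2" using u by (intro power_mono) auto
    also have "\<dots> = v\<^sup>2 * ?G\<^sup>2" by (simp add: power_mult_distrib)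
    also have "\<dots> \<le> ?F * ?u * ?G\<^sup>2" using v by (intro mult_right_mono) auto
    finally have "?u * ?u ^ 3 \<le> ?u * (?F * ?G\<^sup>2)" by (simp add: mult_ac)
    then show ?thesis using False pos by (simp add: mult_le_cancel_left)
  qed (use pos in simp)
qed

lemma card_collisions:
  assumes "finite S" "finite Y" "f ` S \<subseteq> Y"
  shows "card {(u, v). u \<in> S \<and> v \<in> S \<and> f u = f v} = (\<Sum>y\<in>Y. (card {u \<in> S. f u = y})\<^sup>2)"
proof -
  have "{(u, v). u \<in> S \<and> v \<in> S \<and> f u = f v}
      = (\<Union>y\<in>Y. {u \<in> S. f u = y} \<times> {u \<in> S. f u = y})"
    using assms(3) by auto
  also have "card \<dots> = (\<Sum>y\<in>Y. card ({u \<in> S. f u = y} \<times> {u \<in> S. f u = y}))"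
    using assms by (intro card_UN_disjoint) auto
  finally show ?thesis by (simp add: card_cartesian_product power2_eq_square)
qed

lemma card_eq_sum_card_fibres:
  assumes "finite S" "finite Y" "f ` S \<subseteq> Y"
  shows "card S = (\<Sum>y\<in>Y. card {u \<in> S. f u = y})"
  using card_eq_sum sum.group[OF assms, of "\<lambda>_. 1::nat"] assms(1) by simp

text \<open>Cauchy-Schwarz over the fibres of \<open>f\<close>: their sizes add up to
  \<open>card S\<close>, and their squares count the colliding pairs.\<close>

lemma card_power2_le_card_times_collisions:
  assumes "finite S" "finite Y" "f ` S \<subseteq> Y"
  shows "(card S)\<^sup>2 \<le> card Y * card {(u, v). u \<in> S \<and> v \<in> S \<and> f u = f v}"
proof -
  have "(\<Sum>y\<in>Y. real (card {u \<in> S. f u = y}))\<^sup>2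
      \<le> (\<Sum>y\<in>Y. 1) * (\<Sum>y\<in>Y. (real (card {u \<in> S. f u = y}))\<^sup>2)"
    by (intro sum_power2_le_mult_sum) auto
  then have "real ((card S)\<^sup>2) \<le> real (card Y * card {(u, v). u \<in> S \<and> v \<in> S \<and> f u = f v})"
    unfolding card_collisions[OF assms] card_eq_sum_card_fibres[OF assms] by simp
  then show ?thesis by (simp only: of_nat_le_iff)
qed

subsection \<open>Incidences between a Cartesian product and monotone curves\<close>

text \<open>Rank divided by \<open>k\<close>: this cuts \<open>Q\<close> into runs of
  \<open>k\<close> consecutive elements, the last one possibly shorter.\<close>

definition block :: "'a::linorder set \<Rightarrow> nat \<Rightarrow> 'a \<Rightarrow> nat" where
  "block Q k q = card {q' \<in> Q. q' < q} div k"

lemma block_mono: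
  assumes "finite Q" "q \<le> q'" shows "block Q k q \<le> block Q k q'"
  unfolding block_def using assms by (intro div_le_mono card_mono) auto

lemma block_le:
  assumes "finite Q" shows "block Q k q \<le> card Q div k"
  unfolding block_def using assms by (intro div_le_mono card_mono) auto

lemma card_block_le:
  assumes "finite Q" "0 < k" shows "card {q \<in> Q. block Q k q = j} \<le> k"
proof -
  let ?r = "\<lambda>q. card {q' \<in> Q. q' < q}"
  have lt: "?r q < ?r q'" if "q \<in> Q" "q < q'" for q q'
    using that assms by (intro psubset_card_mono) auto
  have "inj_on ?r {q \<in> Q. block Q k q = j}"
  proof (rule inj_onI)
    fix q q' assume "q \<in> {q \<in> Q. block Q k q = j}" "q' \<in> {q \<in> Q. block Q k q = j}" "?r q = ?r q'"
    then show "q = q'" using lt[of q q'] lt[of q' q] by (cases q q' rule: linorder_cases) auto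
  qed
  moreover have "?r ` {q \<in> Q. block Q k q = j} \<subseteq> {j * k ..< j * k + k}"
    unfolding block_def using \<open>0 < k\<close>
    by (auto simp: dividend_less_div_times div_times_less_eq_dividend add.commute[of _ k])
  ultimately have "card {q \<in> Q. block Q k q = j} \<le> card {j * k ..< j * k + k}"
    by (intro card_inj_on_le) auto
  then show ?thesis by simp
qed

text \<open>One representative of each \<open>\<kappa>\<close>-class is charged to the image; every
  other element is charged to its pair with the representative.\<close>

lemma card_le_card_image_plus_pairs:
  assumes "finite G"
  shows "card G \<le> card (\<kappa> ` G) + card {(u, v). u \<in> G \<and> v \<in> G \<and> u \<noteq> v \<and> \<kappa> u = \<kappa> v}"
proof -
  define rep where "rep = inv_into G \<kappa>"
  have rep: "rep (\<kappa> u) \<in> G" "\<kappa> (rep (\<kappa> u)) = \<kappa> u" if "u \<in> G" for u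
    unfolding rep_def using that by (auto intro: inv_into_into f_inv_into_f)
  let ?R = "rep ` \<kappa> ` G"
  have "card G \<le> card (?R \<union> (G - ?R))" using assms by (intro card_mono) auto
  also have "\<dots> \<le> card ?R + card (G - ?R)" by (rule card_Un_le)
  also have "card ?R \<le> card (\<kappa> ` G)" using assms by (intro card_image_le) auto
  also have "card (G - ?R) \<le> card {(u, v). u \<in> G \<and> v \<in> G \<and> u \<noteq> v \<and> \<kappa> u = \<kappa> v}"
  proof (rule card_inj_on_le)
    show "inj_on (\<lambda>u. (u, rep (\<kappa> u))) (G - ?R)" by (auto intro: inj_onI)
    show "(\<lambda>u. (u, rep (\<kappa> u))) ` (G - ?R) \<subseteq> {(u, v). u \<in> G \<and> v \<in> G \<and> u \<noteq> v \<and> \<kappa> u = \<kappa> v}"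
      using rep by auto
    show "finite {(u, v). u \<in> G \<and> v \<in> G \<and> u \<noteq> v \<and> \<kappa> u = \<kappa> v}"
      by (rule finite_subset[of _ "G \<times> G"]) (use assms in auto)
  qed
  finally show ?thesis by simp
qed

definition cell :: "'a::linorder set \<Rightarrow> 'b::linorder set \<Rightarrow> nat \<Rightarrow> nat \<Rightarrow> 'a \<times> 'b \<Rightarrow> nat \<times> nat" where
  "cell Q X k m u = (block Q k (fst u), block X m (snd u))"

text \<open>For equal first coordinates the condition applies in both directions, so such a set is
  the graph of a weakly monotone partial function. The same holds for
  \<open>descending\<close>.\<close>

definition ascending :: "('a::linorder \<times> 'b::linorder) set \<Rightarrow> bool" where
  "ascending G \<longleftrightarrow> (\<forall>u\<in>G. \<forall>v\<in>G. fst u \<le> fst v \<longrightarrow> snd u \<le> snd v)"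

definition descending :: "('a::linorder \<times> 'b::linorder) set \<Rightarrow> bool" where
  "descending G \<longleftrightarrow> (\<forall>u\<in>G. \<forall>v\<in>G. fst u \<le> fst v \<longrightarrow> snd v \<le> snd u)"

text \<open>Along an ascending curve both block indices grow together, so their sum determines the
  cell; along a descending one \<open>i + (?c - j)\<close> does.\<close>

lemma card_cells_of_monotone_le:
  assumes "finite Q" "finite X" "ascending G \<or> descending G"
  shows "card (cell Q X k m ` G) \<le> card Q div k + card X div m + 1"
proof -
  let ?c = "card X div m"
  obtain h where h: "inj_on h (cell Q X k m ` G)" "h ` cell Q X k m ` G \<subseteq> {..card Q div k + ?c}"
  proof (cases "ascending G")
    case True
    show ?thesis
    proof (rule that[of "\<lambda>(i, j). i + j"])
      show "inj_on (\<lambda>(i, j). i + j) (cell Q X k m ` G)"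
      proof (rule inj_onI, elim imageE)
        fix u v w z
        assume *: "(case u of (i, j) \<Rightarrow> i + j) = (case v of (i, j) \<Rightarrow> i + j)"
          "w \<in> G" "z \<in> G" "u = cell Q X k m w" "v = cell Q X k m z"
        obtain q x q' x' where wz: "w = (q, x)" "z = (q', x')" by fastforce
        consider "q \<le> q'" "x \<le> x'" | "q' \<le> q" "x' \<le> x"
          using True *(2,3) wz unfolding ascending_def by (metis fst_conv snd_conv linear)
        then show "u = v"
          using * wz block_mono[OF assms(1), of q q' k] block_mono[OF assms(1), of q' q k]
            block_mono[OF assms(2), of x x' m] block_mono[OF assms(2), of x' x m]
          by cases (auto simp: cell_def)
      qed
      show "(\<lambda>(i, j). i + j) ` cell Q X k m ` G \<subseteq> {..card Q div k + ?c}"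
        using block_le[OF assms(1)] block_le[OF assms(2)] by (auto simp: cell_def intro: add_mono)
    qed
  next
    case False
    then have G: "descending G" using assms by blast
    \<comment> \<open>\<open>?c\<close> bounds every block index in \<open>X\<close>, so the
      truncated subtraction loses nothing.\<close>
    show ?thesis
    proof (rule that[of "\<lambda>(i, j). i + (?c - j)"])
      show "inj_on (\<lambda>(i, j). i + (?c - j)) (cell Q X k m ` G)"
      proof (rule inj_onI, elim imageE)
        fix u v w z
        assume *: "(case u of (i, j) \<Rightarrow> i + (?c - j)) = (case v of (i, j) \<Rightarrow> i + (?c - j))"
          "w \<in> G" "z \<in> G" "u = cell Q X k m w" "v = cell Q X k m z"
        obtain q x q' x' where wz: "w = (q, x)" "z = (q', x')" by fastforce
        consider "q \<le> q'" "x' \<le> x" | "q' \<le> q" "x \<le> x'"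
          using G *(2,3) wz unfolding descending_def by (metis fst_conv snd_conv linear)
        then show "u = v"
          using * wz block_mono[OF assms(1), of q q' k] block_mono[OF assms(1), of q' q k]
            block_mono[OF assms(2), of x x' m] block_mono[OF assms(2), of x' x m]
            block_le[OF assms(2), of m x] block_le[OF assms(2), of m x']
          by cases (auto simp: cell_def)
      qed
      show "(\<lambda>(i, j). i + (?c - j)) ` cell Q X k m ` G \<subseteq> {..card Q div k + ?c}"
        using block_le[OF assms(1)] by (auto simp: cell_def intro: add_mono)
    qed
  qed
  have "card (cell Q X k m ` G) \<le> card {..card Q div k + ?c}"
    using h by (intro card_inj_on_le) auto
  then show ?thesis by simp
qed

lemma card_pairs_in_cell_le:
  assumes "finite Q" "finite X" "0 < k" "0 < m"
  shows "card {(u, v). u \<in> Q \<times> X \<and> v \<in> Q \<times> X \<and> cell Q X k m u = cell Q X k m v}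
    \<le> card Q * card X * (k * m)"
proof -
  have "{(u, v). u \<in> Q \<times> X \<and> v \<in> Q \<times> X \<and> cell Q X k m u = cell Q X k m v}
     = (SIGMA u:Q \<times> X. {q \<in> Q. block Q k q = block Q k (fst u)} \<times>
          {x \<in> X. block X m x = block X m (snd u)})"
    by (auto simp: cell_def)
  also have "card \<dots> = (\<Sum>u\<in>Q \<times> X. card ({q \<in> Q. block Q k q = block Q k (fst u)} \<times>
          {x \<in> X. block X m x = block X m (snd u)}))"
    using assms by (intro card_SigmaI) auto
  also have "\<dots> \<le> (\<Sum>u\<in>Q \<times> X. k * m)"
    unfolding card_cartesian_product using assms by (intro sum_mono mult_mono card_block_le) auto
  finally show ?thesis by (simp add: card_cartesian_product)
qed

text \<open>A curve has at most as many points as it has cells plus ordered pairs of distinct points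
  sharing a cell. By \<open>one\<close> such a pair lies on a single curve, so the pairs of all
  curves together number at most those of the whole grid.\<close>

theorem incidences_monotone_curves_le:
  fixes \<Gamma> :: "'c \<Rightarrow> ('a::linorder \<times> 'b::linorder) set"
  assumes "finite Q" "finite X" "finite C" "0 < k" "0 < m"
    and sub: "\<And>c. c \<in> C \<Longrightarrow> \<Gamma> c \<subseteq> Q \<times> X"
    and mono: "\<And>c. c \<in> C \<Longrightarrow> ascending (\<Gamma> c) \<or> descending (\<Gamma> c)"
    and one: "\<And>c c' u v. \<lbrakk>c \<in> C; c' \<in> C; u \<noteq> v; u \<in> \<Gamma> c; v \<in> \<Gamma> c; u \<in> \<Gamma> c'; v \<in> \<Gamma> c'\<rbrakk> \<Longrightarrow> c = c'"
  shows "(\<Sum>c\<in>C. card (\<Gamma> c))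
    \<le> card C * (card Q div k + card X div m + 1) + card Q * card X * (k * m)"
proof -
  let ?\<kappa> = "cell Q X k m"
  let ?W = "\<lambda>c. {(u, v). u \<in> \<Gamma> c \<and> v \<in> \<Gamma> c \<and> u \<noteq> v \<and> ?\<kappa> u = ?\<kappa> v}"
  have fin: "finite (\<Gamma> c)" if "c \<in> C" for c
    using finite_subset[OF sub[OF that]] assms by simp
  have finW: "finite (?W c)" if "c \<in> C" for c
    by (rule finite_subset[of _ "\<Gamma> c \<times> \<Gamma> c"]) (use fin[OF that] in auto)
  have "(\<Sum>c\<in>C. card (?W c)) = card (\<Union>c\<in>C. ?W c)"
  proof (intro card_UN_disjoint[symmetric] ballI impI)
    fix c c' assume "c \<in> C" "c' \<in> C" "c \<noteq> c'"
    then show "?W c \<inter> ?W c' = {}" using one[of c c'] by blast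
  qed (use assms(3) finW in auto)
  also have "\<dots> \<le> card {(u, v). u \<in> Q \<times> X \<and> v \<in> Q \<times> X \<and> ?\<kappa> u = ?\<kappa> v}"
  proof (rule card_mono)
    show "finite {(u, v). u \<in> Q \<times> X \<and> v \<in> Q \<times> X \<and> ?\<kappa> u = ?\<kappa> v}"
      by (rule finite_subset[of _ "(Q \<times> X) \<times> (Q \<times> X)"]) (use assms in auto)
  qed (use sub in blast)
  also have "\<dots> \<le> card Q * card X * (k * m)"
    using assms by (intro card_pairs_in_cell_le) auto
  finally have W: "(\<Sum>c\<in>C. card (?W c)) \<le> card Q * card X * (k * m)" .
  have "(\<Sum>c\<in>C. card (\<Gamma> c)) \<le> (\<Sum>c\<in>C. (card Q div k + card X div m + 1) + card (?W c))"
  proof (rule sum_mono)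
    fix c assume c: "c \<in> C"
    show "card (\<Gamma> c) \<le> (card Q div k + card X div m + 1) + card (?W c)"
      using card_le_card_image_plus_pairs[OF fin[OF c], of ?\<kappa>]
        card_cells_of_monotone_le[OF assms(1,2) mono[OF c], of k m] by linarith
  qed
  also have "\<dots> = card C * (card Q div k + card X div m + 1) + (\<Sum>c\<in>C. card (?W c))"
    by (subst sum.distrib) simp
  finally show ?thesis using W by linarith
qed

subsection \<open>Rich differences and third moments\<close>

definition diff_reps :: "real set \<Rightarrow> real set \<Rightarrow> real \<Rightarrow> nat" where
  "diff_reps A B x = card {(a, b). a \<in> A \<and> b \<in> B \<and> a - b = x}"

lemma diff_reps_le_card_left: "finite A \<Longrightarrow> diff_reps A B x \<le> card A"
  unfolding diff_reps_def by (rule card_inj_on_le[of fst]) (auto intro!: inj_onI)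

lemma diff_reps_le_card_right: "finite B \<Longrightarrow> diff_reps A B x \<le> card B"
  unfolding diff_reps_def by (rule card_inj_on_le[of snd]) (auto intro!: inj_onI)

text \<open>The block sizes \<open>k\<close> and \<open>m\<close> are chosen so that the curve term takes up at most half
  of the incidences.\<close>

lemma richness_bound_from_incidences:
  fixes W N Q X :: real
  assumes pos: "0 < W" "0 < X"
    and WX: "W * X \<le> N * Q" and WN: "W \<le> N" and W2: "W\<^sup>2 \<le> N * Q\<^sup>2"
    and inc: "\<And>k m :: nat. 0 < k \<Longrightarrow> 0 < m \<Longrightarrow>
      W * X \<le> N * (Q / real k + X / real m + 1) + Q * X * (real k * real m)"
  shows "W ^ 3 * X \<le> 98 * (N * Q)\<^sup>2"
proof -
  have N: "0 < N" using pos WN by linarith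
  have "0 < N * Q" using pos WX by (meson less_le_trans mult_pos_pos)
  then have Q: "0 < Q" using N by (simp add: zero_less_mult_iff)
  show ?thesis
  proof (cases "W * X < 6 * N")
    \<comment> \<open>Here the summand \<open>N\<close> coming from \<open>+ 1\<close> cannot be
      absorbed into \<open>W * X\<close>, but the crude bound \<open>W2\<close> suffices.\<close>
    case True
    have "W ^ 3 * X = W\<^sup>2 * (W * X)" by (simp add: power2_eq_square power3_eq_cube)
    also have "\<dots> \<le> (N * Q\<^sup>2) * (6 * N)"
      using True W2 N Q pos by (intro mult_mono[OF W2]) auto
    also have "\<dots> = 6 * (N * Q)\<^sup>2" by (simp add: power2_eq_square)
    finally show ?thesis by (smt (verit) zero_le_power2)
  next
    case False
    \<comment> \<open>The factor \<open>6\<close> makes the first two curve terms at most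
      \<open>W * X / 6\<close> each, as the third is by the case assumption. Both ratios are at
      least \<open>1\<close>, so rounding up turns \<open>6\<close> into at most \<open>7\<close>;
      this gives \<open>98 = 2 * 7 * 7\<close>.\<close>
    define k where "k = nat \<lceil>6 * (N * Q) / (W * X)\<rceil>"
    define m where "m = nat \<lceil>6 * N / W\<rceil>"
    have k1: "1 \<le> N * Q / (W * X)" using WX pos by (simp add: field_simps)
    have m1: "1 \<le> N / W" using WN pos by (simp add: field_simps)
    have k: "6 * (N * Q / (W * X)) \<le> real k" "real k \<le> 7 * (N * Q / (W * X))"
      unfolding k_def using k1 by (simp_all) linarith+
    have m: "6 * (N / W) \<le> real m" "real m \<le> 7 * (N / W)"
      unfolding m_def using m1 by (simp_all) linarith+
    have kp: "0 < real k" "0 < real m" using k m k1 m1 by linarith+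
    have "N * (Q / real k) \<le> W * X / 6" using k(1) kp pos by (simp add: field_simps)
    moreover have "N * (X / real m) \<le> W * X / 6"
    proof -
      have "6 * N \<le> W * real m" using m(1) pos by (simp add: field_simps)
      then have "6 * N * X \<le> W * real m * X" using pos by (intro mult_right_mono) auto
      then show ?thesis using kp by (simp add: field_simps)
    qed
    moreover have "N \<le> W * X / 6" using False by simp
    moreover have "Q * X * (real k * real m) \<le> Q * X * ((7 * (N * Q / (W * X))) * (7 * (N / W)))"
      using k m kp Q pos N by (intro mult_left_mono mult_mono) auto
    ultimately have "W * X \<le> W * X / 2 + Q * X * ((7 * (N * Q / (W * X))) * (7 * (N / W)))"
      using inc[of k m] kp unfolding distrib_left by linarith
    also have "Q * X * ((7 * (N * Q / (W * X))) * (7 * (N / W))) = 49 * (N * Q)\<^sup>2 / W\<^sup>2"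
      using pos by (simp add: field_simps power2_eq_square)
    finally have "W * X / 2 \<le> 49 * (N * Q)\<^sup>2 / W\<^sup>2" by simp
    then show ?thesis using pos by (simp add: field_simps power2_eq_square power3_eq_cube)
  qed
qed

text \<open>The direction of a row may depend on \<open>p\<close>, as it follows the sign of
  \<open>p\<close> for products; the domain \<open>R\<close> allows for convex sets, whose grid is a
  diagonal strip. \<open>increment_determines\<close> ensures that two distinct translated rows
  \<open>q \<mapsto> g p q - b\<close> share at most one point.\<close>

locale monotone_grid =
  fixes P :: "'p set" and Q :: "'q::linorder set" and R :: "('p \<times> 'q) set"
    and g :: "'p \<Rightarrow> 'q \<Rightarrow> real"
  assumes finite_P: "finite P" and finite_Q: "finite Q" and R_subset: "R \<subseteq> P \<times> Q"
    and strictly_monotone: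
      "(\<forall>q q'. (p, q) \<in> R \<longrightarrow> (p, q') \<in> R \<longrightarrow> q < q' \<longrightarrow> g p q < g p q') \<or>
       (\<forall>q q'. (p, q) \<in> R \<longrightarrow> (p, q') \<in> R \<longrightarrow> q < q' \<longrightarrow> g p q' < g p q)"
    and inj_left: "\<lbrakk>(p, q) \<in> R; (p', q) \<in> R; g p q = g p' q\<rbrakk> \<Longrightarrow> p = p'"
    and increment_determines:
      "\<lbrakk>(p, q) \<in> R; (p, q') \<in> R; (p', q) \<in> R; (p', q') \<in> R; q < q';
        g p q' - g p q = g p' q' - g p' q\<rbrakk> \<Longrightarrow> p = p'"
begin

definition reps :: "real \<Rightarrow> nat" where
  "reps a = card {(p, q). (p, q) \<in> R \<and> g p q = a}"

lemma finite_R: "finite R"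
  using finite_subset[OF R_subset] finite_P finite_Q by simp

lemma card_R_le: "card R \<le> card P * card Q"
  using card_mono[OF _ R_subset] finite_P finite_Q by (simp add: card_cartesian_product)

lemma inj_right: "\<lbrakk>(p, q) \<in> R; (p, q') \<in> R; g p q = g p q'\<rbrakk> \<Longrightarrow> q = q'"
  using strictly_monotone[of p] by (metis less_irrefl linorder_less_linear)

lemma reps_le_card_P: "reps a \<le> card P"
  unfolding reps_def using finite_P R_subset inj_right
  by (intro card_inj_on_le[of fst]) (auto intro!: inj_onI)

lemma reps_le_card_Q: "reps a \<le> card Q"
  unfolding reps_def using finite_Q R_subset inj_left
  by (intro card_inj_on_le[of snd]) (auto intro!: inj_onI)

text \<open>Each representation \<open>x = a - b\<close> comes with at least \<open>T\<close> pairs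
  \<open>(p, q)\<close> such that \<open>g p q = a\<close>, so a \<open>t\<close>-rich
  \<open>x\<close> lies on at least \<open>T * t\<close> incidences with the
  \<open>card P * card B\<close> curves \<open>x = g p q - b\<close>.\<close>

lemma card_rich_differences_le:
  fixes T t :: real
  assumes "finite A" "finite B" "finite X" "0 < T" "0 < t" and AQ: "card A \<le> card Q"
    and T: "\<And>a. a \<in> A \<Longrightarrow> T \<le> reps a"
    and t: "\<And>x. x \<in> X \<Longrightarrow> t \<le> diff_reps A B x"
  shows "(T * t) ^ 3 * card X \<le> 98 * (real (card P * card B) * card Q)\<^sup>2"
proof (cases "X = {}")
  case False
  then obtain x0 where x0: "x0 \<in> X" by blast
  have tA: "t \<le> card A" and tB: "t \<le> card B"
    using t[OF x0] diff_reps_le_card_left[OF assms(1), of B x0]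
      diff_reps_le_card_right[OF assms(2), of A x0] by linarith+
  then obtain a0 where a0: "a0 \<in> A" using \<open>0 < t\<close> by fastforce
  \<comment> \<open>The trivial bounds on \<open>T\<close> and \<open>t\<close> supply the side
    conditions of \<open>richness_bound_from_incidences\<close>; \<open>AQ\<close> is what turns
    \<open>t \<le> card A\<close> into \<open>t \<le> card Q\<close>.\<close>
  have TP: "T \<le> card P" and TQ: "T \<le> card Q"
    using T[OF a0] reps_le_card_P[of a0] reps_le_card_Q[of a0] by linarith+
  have tQ: "t \<le> card Q" using tA AQ by linarith
  let ?W = "T * t" and ?N = "real (card P * card B)"
  have W: "0 < ?W" using assms by simp
  have WN: "?W \<le> ?N" using TP tB assms by (auto intro: mult_mono)
  have "?W * ?W \<le> ?N * (real (card Q) * real (card Q))"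
    using mult_mono[OF WN mult_mono[OF TQ tQ]] assms(4,5) by simp
  then have W2: "?W\<^sup>2 \<le> ?N * (real (card Q))\<^sup>2" by (simp add: power2_eq_square)

  \<comment> \<open>The incidences at height \<open>x\<close>. A triple determines its height, so
    these sets are disjoint parts of \<open>R \<times> B\<close>, which yields
    \<open>WX\<close>.\<close>
  define J where "J x = {((p, q), b). (p, q) \<in> R \<and> b \<in> B \<and> g p q - b = x}" for x
  have Jsub: "J x \<subseteq> R \<times> B" for x by (auto simp: J_def)
  have finJ: "finite (J x)" for x
    using finite_subset[OF Jsub] finite_R assms(2) by simp
  have J: "?W \<le> card (J x)" if "x \<in> X" for x
  proof -
    let ?D = "{(a, b). a \<in> A \<and> b \<in> B \<and> a - b = x}"
    have finD: "finite ?D" by (rule finite_subset[of _ "A \<times> B"]) (use assms in auto)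
    let ?L = "\<lambda>(a, b). {(p, q). (p, q) \<in> R \<and> g p q = a} \<times> {b}"
    have finL: "finite {(p, q). (p, q) \<in> R \<and> g p q = a}" for a
      by (rule finite_subset[OF _ finite_R]) auto
    have "(\<Sum>d\<in>?D. card (?L d)) = card (\<Union>d\<in>?D. ?L d)"
      using finD finL by (intro card_UN_disjoint[symmetric]) auto
    also have "\<dots> \<le> card (J x)"
      by (rule card_mono[OF finJ]) (auto simp: J_def)
    finally have "(\<Sum>d\<in>?D. card (?L d)) \<le> card (J x)" .
    moreover have "T * t \<le> (\<Sum>d\<in>?D. T)"
      using t[OF that] \<open>0 < T\<close> by (simp add: diff_reps_def mult.commute)
    moreover have "(\<Sum>d\<in>?D. T) \<le> (\<Sum>d\<in>?D. real (card (?L d)))"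
      using T by (intro sum_mono) (auto simp: card_cartesian_product reps_def)
    ultimately show ?thesis by (smt (verit) of_nat_mono of_nat_sum sum.cong)
  qed
  have UJ: "(\<Sum>x\<in>X. card (J x)) = card (\<Union>x\<in>X. J x)"
    using assms(3) finJ by (intro card_UN_disjoint[symmetric]) (auto simp: J_def)
  have WX': "?W * card X \<le> real (\<Sum>x\<in>X. card (J x))"
    using sum_mono[of X "\<lambda>_. ?W" "\<lambda>x. real (card (J x))"] J by (simp add: mult.commute)
  have "card (\<Union>x\<in>X. J x) \<le> card (R \<times> B)"
    using Jsub finite_R assms(2) by (intro card_mono) auto
  also have "\<dots> \<le> card P * card Q * card B"
    using card_R_le by (simp add: card_cartesian_product)
  finally have "real (\<Sum>x\<in>X. card (J x)) \<le> real (card P * card Q * card B)"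
    unfolding UJ of_nat_le_iff .
  with WX' have WX: "?W * card X \<le> ?N * card Q" by (simp add: mult_ac)

  define \<Gamma> where "\<Gamma> c = {(q, x). (fst c, q) \<in> R \<and> x \<in> X \<and> x = g (fst c) q - snd c}" for c
  have \<Gamma>sub: "\<Gamma> c \<subseteq> Q \<times> X" for c using R_subset by (auto simp: \<Gamma>_def)
  have fin\<Gamma>: "finite (\<Gamma> c)" for c
    using finite_subset[OF \<Gamma>sub] finite_Q assms(3) by simp
  have "card (\<Union>x\<in>X. J x) \<le> card (SIGMA c:P \<times> B. \<Gamma> c)"
  proof (rule card_inj_on_le)
    show "inj_on (\<lambda>((p, q), b). ((p, b), (q, g p q - b))) (\<Union>x\<in>X. J x)"
      by (auto intro!: inj_onI)
    show "(\<lambda>((p, q), b). ((p, b), (q, g p q - b))) ` (\<Union>x\<in>X. J x) \<subseteq> (SIGMA c:P \<times> B. \<Gamma> c)"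
      using R_subset by (auto simp: J_def \<Gamma>_def)
    show "finite (SIGMA c:P \<times> B. \<Gamma> c)"
      using finite_P assms(2) fin\<Gamma> by auto
  qed
  also have "\<dots> = (\<Sum>c\<in>P \<times> B. card (\<Gamma> c))"
    using finite_P assms(2) fin\<Gamma> by (intro card_SigmaI) auto
  finally have inc: "(\<Sum>x\<in>X. card (J x)) \<le> (\<Sum>c\<in>P \<times> B. card (\<Gamma> c))" unfolding UJ .

  have mono: "ascending (\<Gamma> c) \<or> descending (\<Gamma> c)" for c
    using strictly_monotone[of "fst c"]
    unfolding ascending_def descending_def \<Gamma>_def by (auto simp: le_less)
  have one: "c = c'" if "u \<noteq> v" "u \<in> \<Gamma> c" "v \<in> \<Gamma> c" "u \<in> \<Gamma> c'" "v \<in> \<Gamma> c'" for c c' u v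
  proof -
    obtain q x q' x' where uv: "u = (q, x)" "v = (q', x')" by fastforce
    have *: "(fst c, q) \<in> R" "(fst c, q') \<in> R" "(fst c', q) \<in> R" "(fst c', q') \<in> R"
      "g (fst c) q - snd c = x" "g (fst c) q' - snd c = x'"
      "g (fst c') q - snd c' = x" "g (fst c') q' - snd c' = x'"
      using that uv by (auto simp: \<Gamma>_def)
    have "q \<noteq> q'" using * that(1) uv by auto
    then have "fst c = fst c'"
      using increment_determines[of "fst c" q q' "fst c'"] increment_determines[of "fst c" q' q "fst c'"] *
      by (cases q q' rule: linorder_cases) auto
    moreover from this have "snd c = snd c'" using *(5,7) by simp
    ultimately show ?thesis by (rule prod_eqI)
  qed
  have "?W * card X \<le> ?N * (card Q / real k + card X / real m + 1) + card Q * card X * (real k * real m)"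
    if "0 < k" "0 < m" for k m :: nat
  proof -
    have "(\<Sum>c\<in>P \<times> B. card (\<Gamma> c))
      \<le> card (P \<times> B) * (card Q div k + card X div m + 1) + card Q * card X * (k * m)"
      using finite_P finite_Q assms(2,3) that \<Gamma>sub mono one
      by (intro incidences_monotone_curves_le) blast+
    from of_nat_mono[OF order.trans[OF inc this], where 'a = real]
    have "real (\<Sum>x\<in>X. card (J x)) \<le>
        ?N * (real (card Q div k) + real (card X div m) + 1) + card Q * card X * (real k * real m)"
      by (simp add: card_cartesian_product algebra_simps)
    also have "\<dots> \<le> ?N * (card Q / real k + card X / real m + 1) + card Q * card X * (real k * real m)"
      by (intro add_mono mult_left_mono of_nat_div_le_of_nat) auto
    finally show ?thesis using WX' by linarith
  qed
  with richness_bound_from_incidences[OF W _ WX WN W2] show ?thesis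
    using False assms(3) by (simp add: card_gt_0_iff)
qed simp

text \<open>Dyadic decomposition: the size of the level of popularity about \<open>2 ^ j\<close> is
  bounded by a multiple of \<open>1 / (2 ^ j) ^ 3\<close>, so all levels obey the same bound and
  only their number enters. The constant is \<open>784 = 2 ^ 3 * 98\<close>.\<close>

lemma sum_diff_reps_cubed_le:
  fixes T :: real
  assumes "finite A" "finite B" "finite Y" "0 < T" and AQ: "card A \<le> card Q"
    and T: "\<And>a. a \<in> A \<Longrightarrow> T \<le> reps a"
  shows "(\<Sum>x\<in>Y. real (diff_reps A B x) ^ 3)
    \<le> 784 * real (Suc (floor_log (card A))) * (card P * card Q)\<^sup>2 / T ^ 3 * (card B)\<^sup>2"
proof -
  let ?r = "\<lambda>x. diff_reps A B x"
  let ?l = "floor_log (card A)"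
  let ?M = "98 * (real (card P * card B) * card Q)\<^sup>2"
  define L where "L j = {x \<in> Y. ?r x \<noteq> 0 \<and> floor_log (?r x) = j}" for j
  have fl: "floor_log (?r x) \<le> ?l" for x
    by (intro floor_log_le_iff diff_reps_le_card_left assms)
  have "(\<Sum>x\<in>Y. real (?r x) ^ 3) = (\<Sum>x\<in>{x \<in> Y. ?r x \<noteq> 0}. real (?r x) ^ 3)"
    using assms(3) by (intro sum.mono_neutral_right) auto
  also have "\<dots> = (\<Sum>j\<le>?l. \<Sum>x\<in>L j. real (?r x) ^ 3)"
    using sum.group[of "{x \<in> Y. ?r x \<noteq> 0}" "{..?l}" "\<lambda>x. floor_log (?r x)" "\<lambda>x. real (?r x) ^ 3"]
      assms(3) fl
    by (simp add: L_def conj_assoc image_subset_iff)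
  also have "\<dots> \<le> (\<Sum>j\<le>?l. 8 * ?M / T ^ 3)"
  proof (rule sum_mono)
    fix j
    have fin: "finite (L j)" using assms(3) by (simp add: L_def)
    have "(\<Sum>x\<in>L j. real (?r x) ^ 3) \<le> (\<Sum>x\<in>L j. (2 * 2 ^ j) ^ 3)"
    proof (rule sum_mono)
      fix x assume "x \<in> L j"
      then have "?r x \<le> 2 * 2 ^ j" using floor_log_exp2_ge[of "?r x"] by (auto simp: L_def)
      then have "real (?r x) \<le> 2 * 2 ^ j"
        by (metis of_nat_le_iff of_nat_mult of_nat_numeral of_nat_power)
      then show "real (?r x) ^ 3 \<le> (2 * 2 ^ j) ^ 3" by (intro power_mono) auto
    qed
    also have "\<dots> = 8 * ((2 ^ j) ^ 3 * real (card (L j)))" by (simp add: power_mult_distrib)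
    finally have *: "(\<Sum>x\<in>L j. real (?r x) ^ 3) \<le> 8 * ((2 ^ j) ^ 3 * real (card (L j)))" .
    have "(T * 2 ^ j) ^ 3 * card (L j) \<le> ?M"
    proof (rule card_rich_differences_le[OF assms(1,2) fin assms(4) _ AQ T])
      fix x assume "x \<in> L j"
      then have "2 ^ j \<le> ?r x" using floor_log_exp2_le[of "?r x"] by (auto simp: L_def)
      then show "2 ^ j \<le> real (?r x)" by (metis of_nat_le_iff of_nat_numeral of_nat_power)
    qed auto
    then have "(2 ^ j) ^ 3 * real (card (L j)) \<le> ?M / T ^ 3"
      using assms(4) by (simp add: field_simps power_mult_distrib)
    with * show "(\<Sum>x\<in>L j. real (?r x) ^ 3) \<le> 8 * ?M / T ^ 3" by simp
  qed
  also have "\<dots> = 784 * real (Suc ?l) * (card P * card Q)\<^sup>2 / T ^ 3 * (card B)\<^sup>2"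
    by (simp add: power_mult_distrib field_simps)
  finally show ?thesis .
qed

end

subsection \<open>Growth of sumsets from third moments\<close>

lemma diff_reps_eq_card_fibre: "diff_reps A B x = card {u \<in> A \<times> B. fst u - snd u = x}"
  unfolding diff_reps_def by (rule arg_cong[of _ _ card]) auto

lemma diff_reps_mono:
  assumes "finite A'" "finite B'" "A \<subseteq> A'" "B \<subseteq> B'"
  shows "diff_reps A B x \<le> diff_reps A' B' x"
  unfolding diff_reps_eq_card_fibre using assms by (intro card_mono) auto

text \<open>Elimination of \<open>V\<close>, \<open>u\<close>, \<open>\<tau>\<close>,
  \<open>d\<close> and \<open>\<delta>\<close>. The estimates in \<open>V\<close> bound
  \<open>(\<rho> * \<tau>) ^ 6\<close>, \<open>triples\<close> trades \<open>\<tau>\<close> for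
  \<open>d\<^sup>2 * \<delta>\<^sup>2\<close>, and \<open>F\<close> and \<open>E3\<close> enter in
  the proportion dictated by \<open>(d * \<delta>\<^sup>2) ^ 9 = d ^ 7 * \<delta> ^ 12 * (d *
  \<delta> ^ 3)\<^sup>2\<close>.\<close>

lemma exponent_bookkeeping:
  fixes n s l M d \<delta> \<rho> \<tau> V u :: real
  assumes pos: "0 < n" "0 < s" "0 < l" "0 \<le> M" "0 \<le> d" "0 \<le> \<delta>" "0 \<le> \<tau>" "0 \<le> V"
    and \<rho>: "\<rho> = n\<^sup>2 / (8 * s)"
    and F: "n ^ 4 / (64 * s * l) \<le> d * \<delta>\<^sup>2"
    and E3: "d * \<delta> ^ 3 \<le> M * n\<^sup>2"
    and triples: "(d * \<delta> * n / 2)\<^sup>2 \<le> \<tau> * (M * n\<^sup>2)"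
    and V: "\<rho> * \<tau> \<le> V" "V\<^sup>2 \<le> n * d * u" "u ^ 3 \<le> M * d\<^sup>2 * (M * s\<^sup>2)\<^sup>2"
  shows "n ^ 41 \<le> 2 ^ 84 * l ^ 9 * M ^ 11 * s ^ 19"
proof -
  have \<rho>0: "0 < \<rho>" unfolding \<rho> using pos by simp
  have F0: "0 < n ^ 4 / (64 * s * l)" using pos by simp
  with F have "0 < d * \<delta>\<^sup>2" by linarith
  then have d: "0 < d" using pos by (cases "d = 0") auto
  \<comment> \<open>The sixth power, because \<open>V\<close> is bounded through its square and
    \<open>u\<close> through its cube.\<close>
  have "(\<rho> * \<tau>) ^ 6 \<le> V ^ 6" using V(1) \<rho>0 pos by (intro power_mono) auto
  also have "\<dots> = (V\<^sup>2) ^ 3" by simp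
  also have "\<dots> \<le> (n * d * u) ^ 3" using V(2) by (intro power_mono) auto
  also have "\<dots> = (n * d) ^ 3 * u ^ 3" by (simp add: power_mult_distrib)
  also have "\<dots> \<le> (n * d) ^ 3 * (M * d\<^sup>2 * (M * s\<^sup>2)\<^sup>2)"
    using V(3) pos by (intro mult_left_mono) auto
  finally have a: "(\<rho> * \<tau>) ^ 6 \<le> (n * d) ^ 3 * (M * d\<^sup>2 * (M * s\<^sup>2)\<^sup>2)" .
  have "d\<^sup>2 * \<delta>\<^sup>2 * n\<^sup>2 \<le> 4 * \<tau> * M * n\<^sup>2"
    using triples by (simp add: power_mult_distrib power_divide field_simps)
  then have "d\<^sup>2 * \<delta>\<^sup>2 \<le> 4 * \<tau> * M" using pos by simp
  then have "\<rho> * (d\<^sup>2 * \<delta>\<^sup>2) \<le> 4 * M * (\<rho> * \<tau>)"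
    using mult_left_mono[of _ _ \<rho>] \<rho>0 by (fastforce simp: mult_ac)
  then have "(\<rho> * (d\<^sup>2 * \<delta>\<^sup>2)) ^ 6 \<le> (4 * M * (\<rho> * \<tau>)) ^ 6"
    using \<rho>0 by (intro power_mono) auto
  also have "\<dots> = (4 * M) ^ 6 * (\<rho> * \<tau>) ^ 6" by (rule power_mult_distrib)
  also have "\<dots> \<le> (4 * M) ^ 6 * ((n * d) ^ 3 * (M * d\<^sup>2 * (M * s\<^sup>2)\<^sup>2))"
    using a pos by (intro mult_left_mono) auto
  finally have "d ^ 5 * (\<rho> ^ 6 * d ^ 7 * \<delta> ^ 12) \<le> d ^ 5 * (4 ^ 6 * M ^ 9 * n ^ 3 * s ^ 4)"
    by (simp add: power_mult_distrib power_mult[symmetric] mult_ac power_add[symmetric]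
        flip: power_Suc)
      (simp add: eval_nat_numeral mult_ac)
  then have b: "\<rho> ^ 6 * d ^ 7 * \<delta> ^ 12 \<le> 4 ^ 6 * M ^ 9 * n ^ 3 * s ^ 4"
    using d by (simp add: mult_le_cancel_left)
  have "\<rho> ^ 6 * (n ^ 4 / (64 * s * l)) ^ 9 \<le> \<rho> ^ 6 * (d * \<delta>\<^sup>2) ^ 9"
    using F F0 \<rho>0 by (intro mult_left_mono power_mono) auto
  also have "\<dots> = \<rho> ^ 6 * d ^ 7 * \<delta> ^ 12 * (d * \<delta> ^ 3)\<^sup>2"
    by (simp add: eval_nat_numeral mult_ac)
  also have "\<dots> \<le> 4 ^ 6 * M ^ 9 * n ^ 3 * s ^ 4 * (M * n\<^sup>2)\<^sup>2"
    using pos by (intro mult_mono[OF b power_mono[OF E3]]) auto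
  finally have c: "\<rho> ^ 6 * (n ^ 4 / (64 * s * l)) ^ 9 \<le> 4 ^ 6 * M ^ 9 * n ^ 3 * s ^ 4 * (M * n\<^sup>2)\<^sup>2" .
  have lhs: "\<rho> ^ 6 * (n ^ 4 / (64 * s * l)) ^ 9 = n ^ 48 / (2 ^ 72 * s ^ 15 * l ^ 9)"
    unfolding \<rho> power_divide power_mult_distrib times_divide_times_eq
    by (simp add: mult_ac flip: power_mult power_add)
  have rhs: "4 ^ 6 * M ^ 9 * n ^ 3 * s ^ 4 * (M * n\<^sup>2)\<^sup>2 = 2 ^ 12 * M ^ 11 * n ^ 7 * s ^ 4"
    by (simp add: power_mult_distrib mult_ac flip: power_mult power_add)
  have "n ^ 48 \<le> 2 ^ 12 * M ^ 11 * n ^ 7 * s ^ 4 * (2 ^ 72 * s ^ 15 * l ^ 9)"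
    using c pos unfolding lhs rhs by (subst (asm) pos_divide_le_eq) auto
  also have "\<dots> = n ^ 7 * (2 ^ 84 * l ^ 9 * M ^ 11 * s ^ 19)"
    by (simp add: mult_ac flip: power_add)
  finally have "n ^ 7 * n ^ 41 \<le> n ^ 7 * (2 ^ 84 * l ^ 9 * M ^ 11 * s ^ 19)"
    by (simp flip: power_add)
  then show ?thesis by (rule mult_left_le_imp_le) (use pos in simp)
qed

text \<open>The third moment is controlled for every \<open>B\<close> because it is applied to
  \<open>A\<close>, to the dyadic level \<open>D\<close> and to the popular sums
  \<open>Pop\<close>.\<close>

theorem card_sumset_lower_bound:
  fixes A :: "real set" and M :: real
  assumes fin: "finite A" and ne: "A \<noteq> {}"
    and E3: "\<And>B Y. finite B \<Longrightarrow> finite Y \<Longrightarrow>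
      (\<Sum>x\<in>Y. real (diff_reps A B x) ^ 3) \<le> M * (real (card B))\<^sup>2"
  shows "real (card A) ^ 41
    \<le> 2 ^ 84 * real (Suc (floor_log (card A))) ^ 9 * M ^ 11 * real (card (A + A)) ^ 19"
proof -
  define S where "S = A + A"
  define n where "n = real (card A)"
  define s where "s = real (card S)"
  define l where "l = real (Suc (floor_log (card A)))"
  have finS: "finite S" unfolding S_def using fin fin by (rule finite_set_plus)
  have S: "a + c \<in> S" if "a \<in> A" "c \<in> A" for a c
    unfolding S_def using that by (rule set_plus_intro)
  have n0: "0 < n" unfolding n_def using fin ne by (simp add: card_gt_0_iff)
  have s0: "0 < s" unfolding s_def using finS ne S by (auto simp: card_gt_0_iff)
  have l0: "0 < l" by (simp add: l_def)
  \<comment> \<open>An empty sum against \<open>B = {0}\<close> reads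
    \<open>0 \<le> M\<close>.\<close>
  have M0: "0 \<le> M" using E3[of "{0}" "{}"] by simp

  \<comment> \<open>Popular sums\<close>
  define \<rho> where "\<rho> = n\<^sup>2 / (8 * s)"
  have \<rho>0: "0 < \<rho>" unfolding \<rho>_def using n0 s0 by simp
  define w where "w z = card {u \<in> A \<times> A. fst u + snd u = z}" for z
  define Pop where "Pop = {z \<in> S. \<rho> \<le> real (w z)}"
  define A1 where "A1 = {a \<in> A. real (card {c \<in> A. a + c \<notin> Pop}) \<le> n / 4}"
  have finPop: "finite Pop" "Pop \<subseteq> S" using finS by (auto simp: Pop_def)
  have finA1: "finite A1" "A1 \<subseteq> A" using fin by (auto simp: A1_def)

  \<comment> \<open>Unpopular sums use up at most \<open>s * \<rho> = n\<^sup>2 / 8\<close> pairs,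
    while each \<open>a\<close> outside \<open>A1\<close> starts at least \<open>n / 4\<close> of
    them; so at most \<open>n / 2\<close> elements are lost.\<close>
  have A1: "n / 2 \<le> real (card A1)"
  proof -
    let ?U = "{u \<in> A \<times> A. fst u + snd u \<notin> Pop}"
    have finU: "finite ?U" using fin by auto
    have "card ?U = (\<Sum>z\<in>S - Pop. card {u \<in> ?U. fst u + snd u = z})"
      using finU finS S by (intro card_eq_sum_card_fibres) auto
    also have "\<dots> \<le> (\<Sum>z\<in>S - Pop. w z)"
      unfolding w_def using fin by (intro sum_mono card_mono) auto
    finally have "real (card ?U) \<le> real (\<Sum>z\<in>S - Pop. w z)" by (rule of_nat_mono)
    also have "\<dots> = (\<Sum>z\<in>S - Pop. real (w z))" by simp
    also have "\<dots> \<le> (\<Sum>z\<in>S - Pop. \<rho>)" by (intro sum_mono) (auto simp: Pop_def)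
    also have "\<dots> \<le> s * \<rho>"
      unfolding sum_constant s_def using finS \<rho>0
      by (intro mult_right_mono of_nat_mono card_mono) auto
    also have "\<dots> = n\<^sup>2 / 8" using s0 by (simp add: \<rho>_def)
    finally have U: "real (card ?U) \<le> n\<^sup>2 / 8" .
    have "(n - real (card A1)) * (n / 4) = (\<Sum>a\<in>A - A1. n / 4)"
      using finA1 fin by (simp add: n_def card_Diff_subset card_mono of_nat_diff)
    also have "\<dots> \<le> (\<Sum>a\<in>A - A1. real (card {c \<in> A. a + c \<notin> Pop}))"
      by (intro sum_mono) (auto simp: A1_def)
    also have "\<dots> = real (card (SIGMA a:A - A1. {c \<in> A. a + c \<notin> Pop}))"
      using fin by (subst card_SigmaI) auto
    also have "\<dots> \<le> real (card ?U)"
      using finU by (intro of_nat_mono card_mono) auto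
    finally have "(n - real (card A1)) * (n / 4) \<le> n\<^sup>2 / 8" using U by linarith
    then show ?thesis using n0 by (simp add: power2_eq_square field_simps)
  qed

  \<comment> \<open>Energy of \<open>A1\<close> and its dominant dyadic level\<close>
  define r where "r x = diff_reps A1 A1 x" for x
  define \<Delta> where "\<Delta> = (\<lambda>u. fst u - snd u) ` (A1 \<times> A1)"
  have fin\<Delta>: "finite \<Delta>" using finA1 by (simp add: \<Delta>_def)
  have r_le: "r x \<le> diff_reps A A x" for x
    unfolding r_def using finA1 fin by (intro diff_reps_mono) auto
  \<comment> \<open>Since \<open>floor_log 0 = 0\<close>, a value without representations would pass
    for one of level \<open>0\<close>.\<close>
  have r_pos: "r x \<noteq> 0" if "x \<in> \<Delta>" for x
    using that finA1 unfolding r_def diff_reps_eq_card_fibre \<Delta>_def by (auto simp: card_eq_0_iff)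
  have energy: "n ^ 4 / (16 * s) \<le> (\<Sum>x\<in>\<Delta>. (real (r x))\<^sup>2)"
  proof -
    let ?C = "{(u, v). u \<in> A1 \<times> A1 \<and> v \<in> A1 \<times> A1 \<and> fst u + snd u = fst v + snd v}"
    let ?C' = "{(u, v). u \<in> A1 \<times> A1 \<and> v \<in> A1 \<times> A1 \<and> fst u - snd u = fst v - snd v}"
    have "finite ?C'" by (rule finite_subset[of _ "(A1 \<times> A1) \<times> (A1 \<times> A1)"]) (use finA1 in auto)
    \<comment> \<open>As \<open>a + b = a' + b'\<close> amounts to \<open>a - a' = b' - b\<close>,
      collisions of sums, which Cauchy-Schwarz makes numerous, become collisions of
      differences.\<close>
    moreover have "inj_on (\<lambda>((a, b), (a', b')). ((a, a'), (b', b))) ?C"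
      by (auto intro!: inj_onI)
    ultimately have "card ?C \<le> card ?C'"
      by (intro card_inj_on_le[of "\<lambda>((a, b), (a', b')). ((a, a'), (b', b))"]) auto
    also have "\<dots> = (\<Sum>x\<in>\<Delta>. (r x)\<^sup>2)"
      unfolding r_def diff_reps_eq_card_fibre
      using finA1 fin\<Delta> by (intro card_collisions) (auto simp: \<Delta>_def)
    finally have C: "card ?C \<le> (\<Sum>x\<in>\<Delta>. (r x)\<^sup>2)" .
    have "(card (A1 \<times> A1))\<^sup>2 \<le> card S * card ?C"
      using finA1 finS by (intro card_power2_le_card_times_collisions) (auto intro!: S)
    also have "\<dots> \<le> card S * (\<Sum>x\<in>\<Delta>. (r x)\<^sup>2)" using C by simp
    finally have "real ((card (A1 \<times> A1))\<^sup>2) \<le> real (card S * (\<Sum>x\<in>\<Delta>. (r x)\<^sup>2))"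
      by (rule of_nat_mono)
    then have "real (card A1) ^ 4 \<le> s * (\<Sum>x\<in>\<Delta>. (real (r x))\<^sup>2)"
      by (simp add: s_def card_cartesian_product power_mult_distrib flip: power_add)
    moreover have "(n / 2) ^ 4 \<le> real (card A1) ^ 4"
      using A1 n0 by (intro power_mono) auto
    ultimately show ?thesis using s0 by (simp add: field_simps)
  qed

  define L where "L j = {x \<in> \<Delta>. floor_log (r x) = j}" for j
  let ?l = "floor_log (card A)"
  \<comment> \<open>Pigeonhole: if all \<open>l\<close> levels fell short of the average, their
    total would contradict \<open>energy\<close>.\<close>
  obtain j where j: "n ^ 4 / (16 * s * l) \<le> (\<Sum>x\<in>L j. (real (r x))\<^sup>2)"
  proof (rule ccontr)
    assume "\<not> thesis"
    then have small: "(\<Sum>x\<in>L j. (real (r x))\<^sup>2) < n ^ 4 / (16 * s * l)" for j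
      using that by (meson not_le)
    have "floor_log (r x) \<le> ?l" for x
      using r_le[of x] diff_reps_le_card_left[OF fin, of A x] by (intro floor_log_le_iff) simp
    then have "(\<Sum>x\<in>\<Delta>. (real (r x))\<^sup>2) = (\<Sum>j\<le>?l. \<Sum>x\<in>L j. (real (r x))\<^sup>2)"
      unfolding L_def using fin\<Delta> by (intro sum.group[symmetric]) auto
    also have "\<dots> < (\<Sum>j\<le>?l. n ^ 4 / (16 * s * l))"
      using small by (intro sum_strict_mono) auto
    also have "\<dots> = l * (n ^ 4 / (16 * s * l))" by (simp add: l_def)
    also have "\<dots> = n ^ 4 / (16 * s)" using l0 by simp
    finally show False using energy by simp
  qed
  define D where "D = L j"
  define \<delta> where "\<delta> = (2::real) ^ j"
  define d where "d = real (card D)"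
  have finD: "finite D" "D \<subseteq> \<Delta>" using fin\<Delta> by (auto simp: D_def L_def)
  have D: "\<delta> \<le> real (r x)" "real (r x) \<le> 2 * \<delta>" if "x \<in> D" for x
  proof -
    have "2 ^ j \<le> r x" "r x \<le> 2 * 2 ^ j"
      using that r_pos[of x] floor_log_exp2_le[of "r x"] floor_log_exp2_ge[of "r x"]
      by (auto simp: D_def L_def)
    then show "\<delta> \<le> real (r x)" "real (r x) \<le> 2 * \<delta>"
      unfolding \<delta>_def by (metis of_nat_le_iff of_nat_mult of_nat_numeral of_nat_power)+
  qed
  have \<delta>0: "0 < \<delta>" by (simp add: \<delta>_def)
  have F: "n ^ 4 / (64 * s * l) \<le> d * \<delta>\<^sup>2"
  proof -
    have "(\<Sum>x\<in>D. (real (r x))\<^sup>2) \<le> (\<Sum>x\<in>D. (2 * \<delta>)\<^sup>2)"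
      using D by (intro sum_mono power_mono) auto
    then show ?thesis using j by (simp add: D_def[symmetric] d_def power_mult_distrib)
  qed
  have d3: "d * \<delta> ^ 3 \<le> M * n\<^sup>2"
  proof -
    have "d * \<delta> ^ 3 = (\<Sum>x\<in>D. \<delta> ^ 3)" by (simp add: d_def)
    also have "\<dots> \<le> (\<Sum>x\<in>D. real (diff_reps A A x) ^ 3)"
    proof (intro sum_mono power_mono)
      fix x assume "x \<in> D"
      then show "\<delta> \<le> real (diff_reps A A x)" using D(1)[of x] r_le[of x] by linarith
    qed (use \<delta>0 in auto)
    also have "\<dots> \<le> M * n\<^sup>2" unfolding n_def using fin finD by (intro E3) auto
    finally show ?thesis .
  qed

  \<comment> \<open>Pairs of popular sums with difference in \<open>D\<close>\<close>
  define Y where "Y = {u \<in> Pop \<times> Pop. fst u - snd u \<in> D}"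
  define \<tau> where "\<tau> = real (card Y)"
  have finY: "finite Y" using finPop by (simp add: Y_def)
  have triples: "(d * \<delta> * n / 2)\<^sup>2 \<le> \<tau> * (M * n\<^sup>2)"
  proof -
    define E where "E = {u \<in> A1 \<times> A1. fst u - snd u \<in> D}"
    define H where "H u = {c \<in> A. fst u + c \<in> Pop \<and> snd u + c \<in> Pop}" for u
    define Tr where "Tr = Sigma E H"
    have finE: "finite E" using finA1 by (simp add: E_def)
    have finH: "finite (H u)" for u using fin by (simp add: H_def)
    have finTr: "finite Tr" unfolding Tr_def using finE finH by auto
    have "card E = (\<Sum>x\<in>D. card {u \<in> E. fst u - snd u = x})"
      using finE finD by (intro card_eq_sum_card_fibres) (auto simp: E_def)
    also have "\<dots> = (\<Sum>x\<in>D. r x)"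
      unfolding r_def diff_reps_eq_card_fibre E_def
      by (intro sum.cong arg_cong[of _ _ card]) auto
    finally have "real (card E) = (\<Sum>x\<in>D. real (r x))" by simp
    also have "\<dots> \<ge> (\<Sum>x\<in>D. \<delta>)" using D by (intro sum_mono) auto
    finally have E: "d * \<delta> \<le> real (card E)" by (simp add: d_def)
    \<comment> \<open>Each of the two coordinates excludes at most \<open>n / 4\<close> choices of
      \<open>c\<close>.\<close>
    have H: "n / 2 \<le> real (card (H u))" if "u \<in> E" for u
    proof -
      let ?N = "\<lambda>a. {c \<in> A. a + c \<notin> Pop}"
      have "card A \<le> card (H u \<union> (?N (fst u) \<union> ?N (snd u)))"
        using fin by (intro card_mono) (auto simp: H_def)
      also have "\<dots> \<le> card (H u) + (card (?N (fst u)) + card (?N (snd u)))"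
        by (meson add_left_mono card_Un_le le_trans)
      finally have "n \<le> real (card (H u)) + (real (card (?N (fst u))) + real (card (?N (snd u))))"
        unfolding n_def by linarith
      moreover have "real (card (?N (fst u))) \<le> n / 4" "real (card (?N (snd u))) \<le> n / 4"
        using that by (auto simp: E_def A1_def)
      ultimately show ?thesis by linarith
    qed
    have "d * \<delta> * (n / 2) \<le> real (card E) * (n / 2)"
      using E n0 by (intro mult_right_mono) auto
    also have "\<dots> = (\<Sum>u\<in>E. n / 2)" by simp
    also have "\<dots> \<le> (\<Sum>u\<in>E. real (card (H u)))" using H by (rule sum_mono)
    also have "\<dots> = real (card Tr)" unfolding Tr_def using finE finH by (subst card_SigmaI) auto
    finally have Tr: "d * \<delta> * n / 2 \<le> real (card Tr)" by simp

    define f where "f = (\<lambda>((a, b), c). (a + c, b + c :: real))"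
    let ?C = "{(u, v). u \<in> Tr \<and> v \<in> Tr \<and> f u = f v}"
    let ?Z = "(\<lambda>u. fst u - snd u) ` (A \<times> A)"
    let ?B = "\<lambda>y. {u \<in> A \<times> A. fst u - snd u = y}"
    \<comment> \<open>A collision of \<open>f\<close> means \<open>a - a' = b - b' = c' - c\<close>:
      three pairs from \<open>A\<close> with a common difference, as counted by the third moment of
      \<open>A - A\<close>.\<close>
    have "card ?C \<le> card (SIGMA y:?Z. ?B y \<times> ?B y \<times> ?B y)"
    proof (rule card_inj_on_le)
      let ?h = "\<lambda>(((a, b), c), ((a', b'), c')). (a - a', (a, a'), (b, b'), (c', c :: real))"
      show "inj_on ?h ?C" by (auto intro!: inj_onI)
      show "?h ` ?C \<subseteq> (SIGMA y:?Z. ?B y \<times> ?B y \<times> ?B y)"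
      proof (intro subsetI, elim imageE)
        fix y t assume y: "y = ?h t" and t: "t \<in> ?C"
        obtain a b c a' b' c' where t': "t = (((a, b), c), ((a', b'), c'))" by (metis surj_pair)
        have mem: "a \<in> A" "b \<in> A" "c \<in> A" "a' \<in> A" "b' \<in> A" "c' \<in> A"
          and eq: "a + c = a' + c'" "b + c = b' + c'"
          using t finA1 unfolding t' by (auto simp: f_def Tr_def E_def H_def)
        have "a - a' \<in> ?Z" using mem by (intro image_eqI[of _ _ "(a, a')"]) auto
        moreover have "b - b' = a - a'" "c' - c = a - a'" using eq by linarith+
        ultimately show "y \<in> (SIGMA y:?Z. ?B y \<times> ?B y \<times> ?B y)"
          unfolding y t' using mem by simp
      qed
      show "finite (SIGMA y:?Z. ?B y \<times> ?B y \<times> ?B y)" using fin by auto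
    qed
    also have "\<dots> = (\<Sum>y\<in>?Z. card (?B y \<times> ?B y \<times> ?B y))"
      using fin by (intro card_SigmaI) auto
    also have "\<dots> = (\<Sum>y\<in>?Z. diff_reps A A y ^ 3)"
      by (simp add: card_cartesian_product diff_reps_eq_card_fibre power3_eq_cube mult.assoc)
    finally have "real (card ?C) \<le> real (\<Sum>y\<in>?Z. diff_reps A A y ^ 3)" by (rule of_nat_mono)
    also have "\<dots> = (\<Sum>y\<in>?Z. real (diff_reps A A y) ^ 3)" by simp
    also have "\<dots> \<le> M * n\<^sup>2" unfolding n_def using fin by (intro E3) auto
    finally have C: "real (card ?C) \<le> M * n\<^sup>2" .
    have "f ` Tr \<subseteq> Y" by (auto simp: f_def Tr_def E_def H_def Y_def)
    then have "(card Tr)\<^sup>2 \<le> card Y * card ?C"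
      using finTr finY by (intro card_power2_le_card_times_collisions) auto
    from of_nat_mono[OF this, where 'a = real]
    have "(real (card Tr))\<^sup>2 \<le> \<tau> * real (card ?C)" by (simp add: \<tau>_def)
    also have "\<dots> \<le> \<tau> * (M * n\<^sup>2)" using C by (intro mult_left_mono) (auto simp: \<tau>_def)
    finally have "(real (card Tr))\<^sup>2 \<le> \<tau> * (M * n\<^sup>2)" .
    moreover have "(d * \<delta> * n / 2)\<^sup>2 \<le> (real (card Tr))\<^sup>2"
      using Tr n0 \<delta>0 by (intro power_mono) (auto simp: d_def)
    ultimately show ?thesis by linarith
  qed

  \<comment> \<open>Solutions of \<open>x + z' = a + c\<close> with \<open>x\<close> in
    \<open>D\<close> and \<open>z'\<close> in \<open>Pop\<close>\<close>
  define Z where "Z = (\<lambda>u. fst u - snd u) ` (A \<times> D)"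
  define p where "p y = real (diff_reps A D y)" for y
  \<comment> \<open>The equation reads \<open>a - x = z' - c = y\<close>. As \<open>E3\<close>
    speaks of differences with \<open>A\<close> on the left, the second one is counted as
    \<open>c - z' = - y\<close>.\<close>
  define q where "q y = real (diff_reps A Pop (- y))" for y
  have finZ: "finite Z" unfolding Z_def using fin finD by auto
  define V where "V = (\<Sum>y\<in>Z. p y * q y)"
  define u where "u = (\<Sum>y\<in>Z. p y * q y ^ 2)"
  \<comment> \<open>For \<open>(z, z')\<close> in \<open>Y\<close> put \<open>x = z - z'\<close>;
    popularity of \<open>z\<close> gives at least \<open>\<rho>\<close> ways to write
    \<open>z = a + c\<close>.\<close>
  have V: "\<rho> * \<tau> \<le> V"
  proof -
    let ?W = "\<lambda>z. {v \<in> A \<times> A. fst v + snd v = z}"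
    let ?B = "\<lambda>y. {v \<in> A \<times> D. fst v - snd v = y}"
    let ?B' = "\<lambda>y. {v \<in> A \<times> Pop. fst v - snd v = - y}"
    have "\<rho> * \<tau> = (\<Sum>v\<in>Y. \<rho>)" by (simp add: \<tau>_def)
    also have "\<dots> \<le> (\<Sum>v\<in>Y. real (card (?W (fst v))))"
      by (intro sum_mono) (auto simp: Y_def Pop_def w_def)
    also have "\<dots> = real (card (SIGMA v:Y. ?W (fst v)))"
      using finY fin by (subst card_SigmaI) auto
    also have "card (SIGMA v:Y. ?W (fst v)) \<le> card (SIGMA y:Z. ?B y \<times> ?B' y)"
    proof (rule card_inj_on_le)
      let ?h = "\<lambda>((z, z'), (a, c)). (a - (z - z'), (a, z - z'), (c, z' :: real))"
      show "inj_on ?h (SIGMA v:Y. ?W (fst v))" by (auto intro!: inj_onI)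
      show "?h ` (SIGMA v:Y. ?W (fst v)) \<subseteq> (SIGMA y:Z. ?B y \<times> ?B' y)"
      proof (intro subsetI, elim imageE SigmaE)
        fix y t v va
        assume "y = ?h t" "t = (v, va)" and v: "v \<in> Y" and va: "va \<in> ?W (fst v)"
        then have y: "y = (fst va - (fst v - snd v), (fst va, fst v - snd v), (snd va, snd v))"
          by (simp add: case_prod_beta)
        have "fst va - (fst v - snd v) \<in> Z"
          unfolding Z_def using v va
          by (intro image_eqI[of _ _ "(fst va, fst v - snd v)"]) (auto simp: Y_def)
        moreover have "snd va - snd v = - (fst va - (fst v - snd v))" using va by auto
        ultimately show "y \<in> (SIGMA y:Z. ?B y \<times> ?B' y)"
          unfolding y using v va by (simp add: Y_def mem_Times_iff)
      qed
      show "finite (SIGMA y:Z. ?B y \<times> ?B' y)" using finZ fin finD finPop by auto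
    qed
    also have "card (SIGMA y:Z. ?B y \<times> ?B' y) = (\<Sum>y\<in>Z. card (?B y \<times> ?B' y))"
      using finZ fin finD finPop by (intro card_SigmaI) auto
    finally show ?thesis
      by (simp add: V_def p_def q_def card_cartesian_product diff_reps_eq_card_fibre)
  qed
  have pq: "0 \<le> p y" "0 \<le> q y" for y by (auto simp: p_def q_def)
  have "card (A \<times> D) = (\<Sum>y\<in>Z. diff_reps A D y)"
    unfolding diff_reps_eq_card_fibre
    using fin finD finZ by (intro card_eq_sum_card_fibres) (auto simp: Z_def)
  then have psum: "(\<Sum>y\<in>Z. p y) = n * d"
    by (simp add: p_def n_def d_def card_cartesian_product flip: of_nat_sum of_nat_mult)
  \<comment> \<open>Cauchy-Schwarz with weight \<open>p\<close>, whose total mass is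
    \<open>n * d\<close>.\<close>
  have V2: "V\<^sup>2 \<le> n * d * u"
    unfolding V_def u_def psum[symmetric] using pq
    by (intro sum_power2_le_mult_sum) (auto simp: power2_eq_square mult_ac)
  have "(\<Sum>y\<in>Z. q y ^ 3) = (\<Sum>y\<in>uminus ` Z. real (diff_reps A Pop y) ^ 3)"
    by (subst sum.reindex) (auto simp: q_def)
  also have "\<dots> \<le> M * (real (card Pop))\<^sup>2" using finPop finZ by (intro E3) auto
  also have "\<dots> \<le> M * s\<^sup>2"
    unfolding s_def using finPop finS M0 by (intro mult_left_mono power_mono) (auto intro: card_mono)
  finally have q3: "(\<Sum>y\<in>Z. q y ^ 3) \<le> M * s\<^sup>2" .
  have "u ^ 3 \<le> (\<Sum>y\<in>Z. p y ^ 3) * (\<Sum>y\<in>Z. q y ^ 3)\<^sup>2"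
    unfolding u_def using pq by (intro sum_mult_power2_power3_le)
  also have "\<dots> \<le> M * d\<^sup>2 * (M * s\<^sup>2)\<^sup>2"
    unfolding p_def d_def using q3 pq M0 finD finZ
    by (intro mult_mono power_mono E3) (auto intro!: sum_nonneg)
  finally have u3: "u ^ 3 \<le> M * d\<^sup>2 * (M * s\<^sup>2)\<^sup>2" .
  have "0 \<le> d" "0 \<le> \<tau>" "0 \<le> V"
    using pq by (auto simp: d_def \<tau>_def V_def intro!: sum_nonneg)
  then have "n ^ 41 \<le> 2 ^ 84 * l ^ 9 * M ^ 11 * s ^ 19"
    using exponent_bookkeeping[OF n0 s0 l0 M0 _ _ _ _ \<rho>_def F d3 triples V V2 u3] \<delta>0 by simp
  then show ?thesis by (simp only: n_def l_def s_def S_def)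
qed

subsection \<open>Product representations and convex sets\<close>

lemma Suc_floor_log_le_ln:
  assumes "3 \<le> n" shows "real (Suc (floor_log n)) \<le> 3 * ln (real n)" "1 \<le> ln (real n)"
proof -
  have "exp 1 \<le> real n" using exp_le assms by linarith
  then show ln1: "1 \<le> ln (real n)" using assms by (simp add: ln_ge_iff)
  have "real (floor_log n) \<le> log 2 (real n)"
    using assms by (simp add: floor_log_altdef le_log_of_power)
  also have "\<dots> = ln (real n) / ln 2" by (simp add: log_def)
  \<comment> \<open>\<open>ln (1 / 2) \<le> - 1 / 2\<close> means
    \<open>1 / 2 \<le> ln 2\<close>.\<close>
  also have "\<dots> \<le> ln (real n) / (1 / 2)"
    using ln_le_minus_one[of "1 / 2"] ln1 by (intro divide_left_mono) (auto simp: ln_div)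
  finally show "real (Suc (floor_log n)) \<le> 3 * ln (real n)" using ln1 by simp
qed

context monotone_grid
begin

lemma card_sumset_ge:
  fixes T :: real
  assumes fin: "finite A" and n: "3 \<le> card A" and T0: "0 < T" and AQ: "card A \<le> card Q"
    and T: "\<And>a. a \<in> A \<Longrightarrow> T \<le> reps a"
  shows "real (card A) ^ 41 * T ^ 33
    \<le> 2 ^ 84 * 784 ^ 11 * 3 ^ 20 * ln (real (card A)) ^ 23 * (real (card P) * real (card Q)) ^ 22
      * real (card (A + A)) ^ 19"
proof -
  define l where "l = real (Suc (floor_log (card A)))"
  define K where "K = real (card P) * real (card Q)"
  define s where "s = real (card (A + A))"
  define \<Lambda> where "\<Lambda> = ln (real (card A))"
  define M where "M = 784 * l * K\<^sup>2 / T ^ 3"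
  have "A \<noteq> {}" using n by auto
  moreover have "(\<Sum>x\<in>Y. real (diff_reps A B x) ^ 3) \<le> M * (real (card B))\<^sup>2"
    if "finite B" "finite Y" for B Y
    using sum_diff_reps_cubed_le[OF fin that T0 AQ T] by (simp add: M_def l_def K_def)
  ultimately have "real (card A) ^ 41 \<le> 2 ^ 84 * l ^ 9 * M ^ 11 * s ^ 19"
    unfolding l_def s_def using fin by (intro card_sumset_lower_bound)
  then have "real (card A) ^ 41 * T ^ 33 \<le> 2 ^ 84 * l ^ 9 * M ^ 11 * s ^ 19 * T ^ 33"
    using T0 by (intro mult_right_mono) auto
  also have "\<dots> = 2 ^ 84 * l ^ 9 * (M ^ 11 * T ^ 33) * s ^ 19" by (simp only: mult_ac)
  also have "M ^ 11 * T ^ 33 = 784 ^ 11 * l ^ 11 * K ^ 22"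
    using T0 unfolding M_def power_divide power_mult_distrib by (simp flip: power_mult)
  also have "2 ^ 84 * l ^ 9 * (784 ^ 11 * l ^ 11 * K ^ 22) * s ^ 19
      = (2 ^ 84 * 784 ^ 11) * (l ^ 9 * l ^ 11) * (K ^ 22 * s ^ 19)"
    by (simp only: mult_ac)
  also have "l ^ 9 * l ^ 11 = l ^ 20" by (simp flip: power_add)
  \<comment> \<open>The number of levels gives \<open>3 ^ 20\<close> and a power of
    \<open>\<Lambda>\<close>; since \<open>1 \<le> \<Lambda>\<close>, the exponent \<open>20\<close>
    may be raised to \<open>23\<close>.\<close>
  also have "(2 ^ 84 * 784 ^ 11) * l ^ 20 * (K ^ 22 * s ^ 19)
      \<le> (2 ^ 84 * 784 ^ 11) * (3 ^ 20 * \<Lambda> ^ 23) * (K ^ 22 * s ^ 19)"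
  proof (intro mult_right_mono mult_left_mono)
    have \<Lambda>: "l \<le> 3 * \<Lambda>" "1 \<le> \<Lambda>" unfolding l_def \<Lambda>_def using Suc_floor_log_le_ln[OF n] by auto
    have "l ^ 20 \<le> (3 * \<Lambda>) ^ 20" using \<Lambda> by (intro power_mono) (auto simp: l_def)
    also have "\<dots> = 3 ^ 20 * \<Lambda> ^ 20" by (rule power_mult_distrib)
    also have "\<dots> \<le> 3 ^ 20 * \<Lambda> ^ 23" using \<Lambda> by (intro mult_left_mono power_increasing) auto
    finally show "l ^ 20 \<le> 3 ^ 20 * \<Lambda> ^ 23" .
  qed (auto simp: K_def s_def)
  finally show ?thesis by (simp only: K_def s_def \<Lambda>_def mult_ac)
qed

end

text \<open>The sign of \<open>p\<close> gives the direction of its row, nonzero \<open>q\<close>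
  makes the columns injective, and two increments differ by
  \<open>(p - p') * (q' - q)\<close>.\<close>

lemma monotone_grid_times:
  fixes P Q :: "real set"
  assumes "finite P" "finite Q" "0 \<notin> P" "0 \<notin> Q"
  shows "monotone_grid P Q (P \<times> Q) (*)"
proof
  fix p :: real
  show "(\<forall>q q'. (p, q) \<in> P \<times> Q \<longrightarrow> (p, q') \<in> P \<times> Q \<longrightarrow> q < q' \<longrightarrow> p * q < p * q') \<or>
    (\<forall>q q'. (p, q) \<in> P \<times> Q \<longrightarrow> (p, q') \<in> P \<times> Q \<longrightarrow> q < q' \<longrightarrow> p * q' < p * q)"
    using assms(3) by (cases p "0::real" rule: linorder_cases) auto
next
  fix p q p' q' :: real
  assume "q < q'" "p * q' - p * q = p' * q' - p' * q"
  then have "(p - p') * (q' - q) = 0" by (simp add: algebra_simps)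
  with \<open>q < q'\<close> show "p = p'" by simp
qed (use assms in auto)

text \<open>Both sides telescope into \<open>k\<close> consecutive gaps, which are compared term by
  term.\<close>

lemma strict_convex_increment:
  fixes a :: "nat \<Rightarrow> real"
  assumes "strict_mono_on {1..<n} (\<lambda>i. a (i + 1) - a i)" "1 \<le> i" "i < j" "0 < k" "j + k \<le> n"
  shows "a (i + k) - a i < a (j + k) - a j"
proof -
  have "(\<Sum>t<k. a (i + Suc t) - a (i + t)) < (\<Sum>t<k. a (j + Suc t) - a (j + t))"
  proof (rule sum_strict_mono)
    fix t assume "t \<in> {..<k}"
    then show "a (i + Suc t) - a (i + t) < a (j + Suc t) - a (j + t)"
      using strict_mono_onD[OF assms(1), of "i + t" "j + t"] assms by simp
  qed (use assms in auto)
  then show ?thesis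
    using sum_lessThan_telescope[of "\<lambda>t. a (i + t)" k] sum_lessThan_telescope[of "\<lambda>t. a (j + t)" k]
    by simp
qed

text \<open>Row \<open>p\<close> is the sequence \<open>a\<close> shifted by \<open>p\<close>.
  Between two fixed columns, distinct rows take the same step \<open>q' - q\<close> from distinct
  indices, so strict convexity separates their increments.\<close>

lemma monotone_grid_convex:
  fixes a :: "nat \<Rightarrow> real"
  assumes "strict_mono_on {1..n} a" and conv: "strict_mono_on {1..<n} (\<lambda>i. a (i + 1) - a i)"
  shows "monotone_grid {1..n} {1..2 * n} {(p, q). p \<in> {1..n} \<and> p < q \<and> q \<le> p + n}
    (\<lambda>p q. a (q - p))"
proof
  have lt: "a i < a j" if "1 \<le> i" "i < j" "j \<le> n" for i j
    using strict_mono_onD[OF assms(1), of i j] that by simp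
  fix p q p' q' :: nat
  let ?R = "{(p, q). p \<in> {1..n} \<and> p < q \<and> q \<le> p + n}"
  show "(\<forall>q q'. (p, q) \<in> ?R \<longrightarrow> (p, q') \<in> ?R \<longrightarrow> q < q' \<longrightarrow> a (q - p) < a (q' - p)) \<or>
    (\<forall>q q'. (p, q) \<in> ?R \<longrightarrow> (p, q') \<in> ?R \<longrightarrow> q < q' \<longrightarrow> a (q' - p) < a (q - p))"
    using lt by (intro disjI1) auto
  show "p = p'" if "(p, q) \<in> ?R" "(p', q) \<in> ?R" "a (q - p) = a (q - p')"
  proof -
    have "1 \<le> q - p" "q - p \<le> n" "1 \<le> q - p'" "q - p' \<le> n" using that by auto
    then have "q - p = q - p'"
      using lt[of "q - p" "q - p'"] lt[of "q - p'" "q - p"] that(3)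
      by (cases "q - p" "q - p'" rule: linorder_cases) auto
    then show ?thesis using that by auto
  qed
  show "p = p'" if "(p, q) \<in> ?R" "(p, q') \<in> ?R" "(p', q) \<in> ?R" "(p', q') \<in> ?R" "q < q'"
    "a (q' - p) - a (q - p) = a (q' - p') - a (q - p')"
  proof -
    have sum: "q - p + (q' - q) = q' - p" "q - p' + (q' - q) = q' - p'" using that by auto
    have "1 \<le> q - p" "q' - p \<le> n" "1 \<le> q - p'" "q' - p' \<le> n" "0 < q' - q" using that by auto
    then have "q - p = q - p'"
      using strict_convex_increment[OF conv, of "q - p" "q - p'" "q' - q"]
        strict_convex_increment[OF conv, of "q - p'" "q - p" "q' - q"] that(6)
      unfolding sum by (cases "q - p" "q - p'" rule: linorder_cases) auto
    then show ?thesis using that by auto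
  qed
qed auto

lemma card_sumset_ge_of_convex:
  assumes "convex_fin_set A" "3 \<le> card A"
  shows "real (card A) ^ 30
    \<le> 2 ^ 84 * 784 ^ 11 * 3 ^ 20 * 2 ^ 22 * ln (real (card A)) ^ 23 * real (card (A + A)) ^ 19"
proof -
  obtain n :: nat and a :: "nat \<Rightarrow> real" where A: "A = a ` {1..n}" and a: "strict_mono_on {1..n} a"
    and conv: "strict_mono_on {1..<n} (\<lambda>i. a (i + 1) - a i)"
    using assms(1) unfolding convex_fin_set_def by blast
  have n: "card A = n" unfolding A using strict_mono_on_imp_inj_on[OF a] by (simp add: card_image)
  interpret monotone_grid "{1..n}" "{1..2 * n}" "{(p, q). p \<in> {1..n} \<and> p < q \<and> q \<le> p + n}"
    "\<lambda>p q. a (q - p)"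
    using a conv by (rule monotone_grid_convex)
  \<comment> \<open>The element \<open>a i\<close> occurs in each of the \<open>n\<close> rows, in
    column \<open>p + i\<close>; this is why \<open>2 * n\<close> columns are provided.\<close>
  have "n \<le> reps x" if x: "x \<in> A" for x
  proof -
    obtain i where i: "i \<in> {1..n}" "x = a i" using x A by blast
    have "card {1..n} \<le> reps x"
      unfolding reps_def
    proof (rule card_inj_on_le)
      show "finite {(p, q). (p, q) \<in> {(p, q). p \<in> {1..n} \<and> p < q \<and> q \<le> p + n} \<and> a (q - p) = x}"
        by (rule finite_subset[OF _ finite_R]) auto
      show "(\<lambda>p. (p, p + i)) ` {1..n}
          \<subseteq> {(p, q). (p, q) \<in> {(p, q). p \<in> {1..n} \<and> p < q \<and> q \<le> p + n} \<and> a (q - p) = x}"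
        using i by auto
    qed (auto intro: inj_onI)
    then show ?thesis by simp
  qed
  then have "real n ^ 41 * real n ^ 33
    \<le> 2 ^ 84 * 784 ^ 11 * 3 ^ 20 * ln (real n) ^ 23 * (real n * (2 * real n)) ^ 22
      * real (card (A + A)) ^ 19"
    using card_sumset_ge[of A "real n"] n assms(2) A by simp
  \<comment> \<open>Exponents: \<open>41 + 33 = 44 + 30\<close>, where \<open>44\<close> comes from
    the grid size \<open>2 * n\<^sup>2\<close> raised to the power \<open>22\<close>.\<close>
  then have "real n ^ 44 * real n ^ 30
    \<le> real n ^ 44 * (2 ^ 84 * 784 ^ 11 * 3 ^ 20 * 2 ^ 22 * ln (real n) ^ 23 * real (card (A + A)) ^ 19)"
    by (simp add: power_mult_distrib mult_ac flip: power_add)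
  then have "real n ^ 30
    \<le> 2 ^ 84 * 784 ^ 11 * 3 ^ 20 * 2 ^ 22 * ln (real n) ^ 23 * real (card (A + A)) ^ 19"
    by (rule mult_left_le_imp_le) (use n assms(2) in simp)
  then show ?thesis unfolding n .
qed

theorem theorem5p2:
  "(\<exists>c > (0 :: real). \<exists>N :: nat. \<forall>(A :: real set) (P1 :: real set) (P2 :: real set) (T :: real).
      finite A \<and> finite P1 \<and> finite P2 \<and> 0 \<notin> A \<and> 0 \<notin> P1 \<and> 0 \<notin> P2 \<and>
      card A \<ge> N \<and> card P1 \<ge> card A \<and> card P2 \<ge> card A \<and>
      T \<ge> 1 \<and> (\<forall>a\<in>A. real (mult_reps P1 P2 a) \<ge> T) \<longrightarrow>
      real (card (A + A)) ^ 19 * real (card P1) ^ 22 * real (card P2) ^ 22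
        \<ge> c * (real (card A) ^ 41 * T ^ 33 * ln (real (card A)) powi (-23)))
   \<and>
   (\<exists>c > (0 :: real). \<exists>N :: nat. \<forall>A :: real set.
      finite A \<and> 0 \<notin> A \<and> card A \<ge> N \<and> convex_fin_set A \<longrightarrow>
      real (card (A + A))
        \<ge> c * (real (card A) powr (30 / 19) * ln (real (card A)) powr (- 23 / 19)))"
proof (intro conjI)
  define K :: real where "K = 2 ^ 84 * 784 ^ 11 * 3 ^ 20"
  have K: "0 < K" by (simp add: K_def)
  show "\<exists>c > (0 :: real). \<exists>N :: nat. \<forall>(A :: real set) (P1 :: real set) (P2 :: real set) (T :: real).
      finite A \<and> finite P1 \<and> finite P2 \<and> 0 \<notin> A \<and> 0 \<notin> P1 \<and> 0 \<notin> P2 \<and>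
      card A \<ge> N \<and> card P1 \<ge> card A \<and> card P2 \<ge> card A \<and>
      T \<ge> 1 \<and> (\<forall>a\<in>A. real (mult_reps P1 P2 a) \<ge> T) \<longrightarrow>
      real (card (A + A)) ^ 19 * real (card P1) ^ 22 * real (card P2) ^ 22
        \<ge> c * (real (card A) ^ 41 * T ^ 33 * ln (real (card A)) powi (-23))"
  proof (rule exI[of _ "1 / K"], intro conjI exI[of _ 3] allI impI; (elim conjE)?)
    fix A P1 P2 :: "real set" and T :: real
    assume h: "finite A" "finite P1" "finite P2" "0 \<notin> P1" "0 \<notin> P2"
      "card A \<ge> 3" "card P2 \<ge> card A" "T \<ge> 1" "\<forall>a\<in>A. real (mult_reps P1 P2 a) \<ge> T"
    interpret monotone_grid P1 P2 "P1 \<times> P2" "(*)"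
      using h by (intro monotone_grid_times)
    have "reps a = mult_reps P1 P2 a" for a
      unfolding reps_def mult_reps_def by (rule arg_cong[of _ _ card]) auto
    then have "real (card A) ^ 41 * T ^ 33 \<le> K * ln (real (card A)) ^ 23
        * (real (card P1) * real (card P2)) ^ 22 * real (card (A + A)) ^ 19"
      unfolding K_def using h by (intro card_sumset_ge) auto
    moreover have "0 < ln (real (card A))" using Suc_floor_log_le_ln(2)[OF h(6)] by simp
    ultimately show "1 / K * (real (card A) ^ 41 * T ^ 33 * ln (real (card A)) powi (-23))
        \<le> real (card (A + A)) ^ 19 * real (card P1) ^ 22 * real (card P2) ^ 22"
      using K by (simp add: power_int_minus field_simps power_mult_distrib)
  qed (use K in simp)
  show "\<exists>c > (0 :: real). \<exists>N :: nat. \<forall>A :: real set.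
      finite A \<and> 0 \<notin> A \<and> card A \<ge> N \<and> convex_fin_set A \<longrightarrow>
      real (card (A + A))
        \<ge> c * (real (card A) powr (30 / 19) * ln (real (card A)) powr (- 23 / 19))"
  proof (rule exI[of _ "(1 / (K * 2 ^ 22)) powr (1 / 19)"], intro conjI exI[of _ 3] allI impI; (elim conjE)?)
    fix A :: "real set"
    assume h: "card A \<ge> 3" "convex_fin_set A"
    define n where "n = real (card A)"
    define s where "s = real (card (A + A))"
    have ln: "0 < ln n" unfolding n_def using Suc_floor_log_le_ln(2)[OF h(1)] by simp
    have n: "0 < n" unfolding n_def using h by simp
    have "n ^ 30 \<le> K * 2 ^ 22 * ln n ^ 23 * s ^ 19"
      unfolding n_def s_def K_def by (rule card_sumset_ge_of_convex[OF h(2,1)])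
    then have "1 / (K * 2 ^ 22) * (n ^ 30 / ln n ^ 23) \<le> s ^ 19"
      using K ln by (simp add: field_simps)
    then have *: "(1 / (K * 2 ^ 22) * (n ^ 30 / ln n ^ 23)) powr (1 / 19) \<le> (s ^ 19) powr (1 / 19)"
      using K ln n by (intro powr_mono2) auto
    have root: "(x ^ k) powr (1 / 19) = x powr (real k / 19)" if "0 < x" for x :: real and k
      using that by (simp add: powr_powr powr_realpow[symmetric] del: powr_realpow)
    \<comment> \<open>\<open>root\<close> covers only positive bases; for \<open>s = 0\<close> both
      sides vanish.\<close>
    have "0 < s \<or> s = 0" by (auto simp: s_def)
    then have "(s ^ 19) powr (1 / 19) = s" using root[of s 19] by auto
    moreover have "(n ^ 30) powr (1 / 19) = n powr (30 / 19)"
      "(ln n ^ 23) powr (1 / 19) = ln n powr (23 / 19)"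
      using root[OF n, of 30] root[OF ln, of 23] by simp_all
    ultimately have "(1 / (K * 2 ^ 22)) powr (1 / 19) * (n powr (30 / 19) / ln n powr (23 / 19)) \<le> s"
      using * K n ln by (simp add: powr_mult powr_divide)
    then show "(1 / (K * 2 ^ 22)) powr (1 / 19) *
        (real (card A) powr (30 / 19) * ln (real (card A)) powr (- 23 / 19)) \<le> real (card (A + A))"
      unfolding n_def s_def by (simp add: powr_minus_divide)
  qed (use K in simp)
qed

end
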